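(* Let $n\ge1$. Then $T\in\mathcal{M}_n$ if and only if $T\in(2\mathbb{Z})^n\rtimes\operatorname{GL}(\mathbb{Z}^n)$; that is, a function $T:\mathbb{R}^n\to\mathbb{R}^n$ is maximal mediated set preserving if and only if $$T(x)=A_T x+b_T\qquad (x\in\mathbb{R}^n)$$ is a unimodular affine transformation (i.e. $A_T\in\mathbb{Z}^{n\times n}$ with $\det(A_T)=\pm1$) with $b_T\in(2\mathbb{Z})^n$.
   Context: A finite set $\Delta\subset(2\mathbb{Z})^n$ is called $k$-simplicial (or a $k$-dimensional simplicial set) if $\operatorname{conv}(\Delta)\subset\mathbb{R}^n$ is a $k$-simplex with vertex set $\Delta$, i.e. $\Delta$ consists of $k+1$ affinely independent points with all coordinates even integers. For $L\subseteq\mathbb{Z}^n$ put $\operatorname{Mid}(L)=\{\tfrac{s+t}{2} : s,t\in L\cap(2\mathbb{Z})^n,\ s\neq t\}$. For a finite set $\Delta\subset(2\mathbb{Z})^n$, a set $L\subseteq\mathbb{Z}^n$ is $\Delta$-mediated if $\Delta\subseteq L\subseteq\operatorname{Mid}(L)\cup\Delta$. The maximal $\Delta$-mediated set $\Delta^*$ is the (unique, existing) $\Delta$-mediated set containing every $\Delta$-mediated set; it satisfies $\Delta\cup\operatorname{Mid}(\Delta)\subseteq\Delta^*\subseteq\operatorname{conv}(\Delta)\cap\mathbb{Z}^n$. A function $T:\mathbb{R}^n\to\mathbb{R}^n$ is called maximal mediated set preserving (MMS preserving) if for every $k$ and every $k$-dimensional simplicial set $\Delta\subseteq(2\mathbb{Z})^n$: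 (1) $T(\Delta)\subseteq(2\mathbb{Z})^n$ is a $k$-dimensional simplicial set; (2) for every $q\in T(\Delta)^*$ there exists a unique $p\in\Delta^*$ with $T(p)=q$; (3) for every $q\in\operatorname{conv}(T(\Delta))\cap\mathbb{Z}^n$ there exists a unique $p\in\operatorname{conv}(\Delta)\cap\mathbb{Z}^n$ with $T(p)=q$. $(2\mathbb{Z})^n\rtimes\operatorname{GL}(\mathbb{Z}^n)$ denotes the group of affine maps $x\mapsto Ax+b$ of $\mathbb{R}^n$ with $A\in\mathbb{Z}^{n\times n}$, $\det A=\pm1$, and $b\in(2\mathbb{Z})^n$. The maximal mediated set preserving group is $$\mathcal{M}_n=\{T\in(2\mathbb{Z})^n\rtimes\operatorname{GL}(\mathbb{Z}^n) : T\text{ is maximal mediated set preserving}\}$$ with composition of functions.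
   Formalization: The second "iff" fails for arbitrary T, since the definition sees only integer points: it is proved with T(x)=A_T x+b_T for x in Z^n, and for x in R^n when T is affine. Mediated sets L are taken finite; otherwise Z^n is mediated and Δ* is not inside conv(Δ). *)

theory Defs
  imports "HOL-Analysis.Analysis"
begin

definition int_lattice :: "(real ^ 'n) set" where
  "int_lattice = {x. \<forall>i. x $ i \<in> \<int>}"

definition even_lattice :: "(real ^ 'n) set" where
  "even_lattice = {x. \<forall>i. \<exists>m::int. x $ i = 2 * of_int m}"

definition k_simplicial :: "nat \<Rightarrow> (real ^ 'n) set \<Rightarrow> bool" where
  "k_simplicial k \<Delta> \<longleftrightarrow>
     finite \<Delta> \<and> \<Delta> \<subseteq> even_lattice \<and>
     int k simplex (convex hull \<Delta>) \<and> {v. v extreme_point_of (convex hull \<Delta>)} = \<Delta>"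

lemma k_simplicial_iff:
  "k_simplicial k \<Delta> \<longleftrightarrow> \<Delta> \<subseteq> even_lattice \<and> \<not> affine_dependent \<Delta> \<and> card \<Delta> = k + 1"
proof
  assume L: "k_simplicial k \<Delta>"
  then obtain C where C: "\<not> affine_dependent C" "int (card C) = int k + 1"
      "convex hull \<Delta> = convex hull C"
    unfolding k_simplicial_def simplex_def by blast
  have "{v. v extreme_point_of (convex hull C)} = C"
    by (simp add: extreme_point_of_convex_hull_affine_independent[OF C(1)])
  then have "C = \<Delta>" using L C(3) unfolding k_simplicial_def by simp
  then show "\<Delta> \<subseteq> even_lattice \<and> \<not> affine_dependent \<Delta> \<and> card \<Delta> = k + 1"
    using L C(1,2) by (simp add: k_simplicial_def)
next
  assume R: "\<Delta> \<subseteq> even_lattice \<and> \<not> affine_dependent \<Delta> \<and> card \<Delta> = k + 1"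
  then show "k_simplicial k \<Delta>"
    by (simp add: k_simplicial_def extreme_point_of_convex_hull_affine_independent
        aff_independent_finite simplex_convex_hull)
qed

definition Mid :: "(real ^ 'n) set \<Rightarrow> (real ^ 'n) set" where
  "Mid L = {(1 / 2) *\<^sub>R (s + t) | s t.
     s \<in> L \<inter> even_lattice \<and> t \<in> L \<inter> even_lattice \<and> s \<noteq> t}"

text \<open>
  Mediated sets are required to be finite. Without this the whole integer lattice would be
  mediated for every \<open>\<Delta>\<close>, and the largest mediated set would not lie in
  the convex hull of \<open>\<Delta>\<close>.
\<close>

definition mediated :: "(real ^ 'n) set \<Rightarrow> (real ^ 'n) set \<Rightarrow> bool" where
  "mediated \<Delta> L \<longleftrightarrow> finite L \<and> L \<subseteq> int_lattice \<and> \<Delta> \<subseteq> L \<and> L \<subseteq> Mid L \<union> \<Delta>"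

definition max_mediated :: "(real ^ 'n) set \<Rightarrow> (real ^ 'n) set" where
  "max_mediated \<Delta> = (GREATEST L. mediated \<Delta> L)"

lemma Mid_mono: "L \<subseteq> M \<Longrightarrow> Mid L \<subseteq> Mid M"
  unfolding Mid_def by blast

lemma Mid_subset_int_lattice: "Mid (L :: (real ^ 'n) set) \<subseteq> int_lattice"
proof
  fix x :: "real ^ 'n"
  assume "x \<in> Mid L"
  then obtain s t where x: "x = (1 / 2) *\<^sub>R (s + t)" and s: "s \<in> even_lattice" and t: "t \<in> even_lattice"
    unfolding Mid_def by auto
  have "x $ i \<in> \<int>" for i
  proof -
    obtain a b :: int where "s $ i = 2 * of_int a" "t $ i = 2 * of_int b"
      using s t unfolding even_lattice_def by blast
    then have "x $ i = of_int (a + b)" by (simp add: x)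
    then show ?thesis by (metis Ints_of_int)
  qed
  then show "x \<in> int_lattice" by (simp add: int_lattice_def)
qed

lemma even_lattice_subset_int_lattice: "(even_lattice :: (real ^ 'n) set) \<subseteq> int_lattice"
proof
  fix x :: "real ^ 'n"
  assume "x \<in> even_lattice"
  then have "\<exists>m::int. x $ i = 2 * of_int m" for i
    by (simp add: even_lattice_def)
  then have "x $ i \<in> \<int>" for i
    by (metis Ints_mult Ints_numeral Ints_of_int)
  then show "x \<in> int_lattice" by (simp add: int_lattice_def)
qed

lemma mediated_subset_convex_hull:
  assumes "mediated \<Delta> L"
  shows "L \<subseteq> convex hull \<Delta>"
proof -
  have fin: "finite L" and sub: "L \<subseteq> Mid L \<union> \<Delta>"
    using assms unfolding mediated_def by auto
  have "x \<in> \<Delta>" if x: "x extreme_point_of (convex hull L)" for x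
  proof (rule ccontr)
    assume "x \<notin> \<Delta>"
    moreover have "x \<in> L" using x by (rule extreme_point_of_convex_hull)
    ultimately have "x \<in> Mid L" using sub by blast
    then obtain s t where st: "x = (1 / 2) *\<^sub>R (s + t)" "s \<in> L" "t \<in> L" "s \<noteq> t"
      unfolding Mid_def by auto
    then have "x = midpoint s t" by (simp add: midpoint_def)
    then have "x \<in> open_segment s t" using \<open>s \<noteq> t\<close> by simp
    moreover have "s \<in> convex hull L" "t \<in> convex hull L" using st by (simp_all add: hull_inc)
    ultimately show False using x unfolding extreme_point_of_def by blast
  qed
  then have "{x. x extreme_point_of (convex hull L)} \<subseteq> \<Delta>" by blast
  then have "convex hull {x. x extreme_point_of (convex hull L)} \<subseteq> convex hull \<Delta>"
    by (rule hull_mono)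
  then have "convex hull L \<subseteq> convex hull \<Delta>"
    by (simp only: Krein_Milman_polytope[OF fin, symmetric])
  then show ?thesis using hull_subset[of L convex] by (rule order_trans[rotated])
qed

lemma finite_int_lattice_Int_bounded:
  fixes S :: "(real ^ 'n) set"
  assumes "bounded S"
  shows "finite (S \<inter> int_lattice)"
proof -
  obtain B where B: "\<And>x. x \<in> S \<Longrightarrow> norm x \<le> B" using assms bounded_iff by blast
  let ?K = "{z::real. z \<in> \<int> \<and> \<bar>z\<bar> \<le> B}"
  have "x \<in> vec_lambda ` (PiE UNIV (\<lambda>_::'n. ?K))" if "x \<in> S \<inter> int_lattice" for x
  proof
    show "x = vec_lambda (vec_nth x)" by simp
    show "vec_nth x \<in> PiE UNIV (\<lambda>_::'n. ?K)"
    proof (rule PiE_I)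
      fix i
      have "\<bar>x $ i\<bar> \<le> norm x" by (rule component_le_norm_cart)
      also have "norm x \<le> B" using that B by simp
      finally show "x $ i \<in> ?K" using that by (simp add: int_lattice_def)
    qed simp
  qed
  moreover have "finite (PiE UNIV (\<lambda>_::'n. ?K))"
    by (intro finite_PiE finite_class.finite_UNIV finite_abs_int_segment)
  ultimately have "S \<inter> int_lattice \<subseteq> vec_lambda ` (PiE UNIV (\<lambda>_::'n. ?K))"
    and "finite (vec_lambda ` (PiE UNIV (\<lambda>_::'n. ?K)))" by (blast, simp only: finite_imageI)
  then show ?thesis by (rule finite_subset)
qed

lemma mediated_Union:
  fixes \<Delta> :: "(real ^ 'n) set"
  assumes "finite \<Delta>" "\<Delta> \<subseteq> even_lattice"
  shows "mediated \<Delta> (\<Union>{L. mediated \<Delta> L})"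
proof -
  let ?U = "\<Union>{L. mediated \<Delta> L}"
  have "mediated \<Delta> \<Delta>"
    using assms even_lattice_subset_int_lattice unfolding mediated_def by blast
  moreover have int: "?U \<subseteq> int_lattice" unfolding mediated_def by blast
  moreover have "?U \<subseteq> convex hull \<Delta>" using mediated_subset_convex_hull by blast
  then have "?U \<subseteq> convex hull \<Delta> \<inter> int_lattice" using int by (rule Int_greatest)
  then have "finite ?U"
    by (rule finite_subset)
      (intro finite_int_lattice_Int_bounded bounded_convex_hull finite_imp_bounded assms(1))
  moreover have "?U \<subseteq> Mid ?U \<union> \<Delta>"
  proof (rule Union_least)
    fix L
    assume "L \<in> {L. mediated \<Delta> L}"
    then have "L \<subseteq> Mid L \<union> \<Delta>" "L \<subseteq> ?U" unfolding mediated_def by auto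
    then show "L \<subseteq> Mid ?U \<union> \<Delta>" using Mid_mono[of L ?U] by blast
  qed
  moreover have "\<Delta> \<subseteq> ?U" using \<open>mediated \<Delta> \<Delta>\<close> by (intro Union_upper) simp
  ultimately show ?thesis by (simp only: mediated_def)
qed

lemma max_mediated_eq_Union:
  assumes "finite \<Delta>" "\<Delta> \<subseteq> even_lattice"
  shows "max_mediated \<Delta> = \<Union>{L. mediated \<Delta> L}"
  unfolding max_mediated_def
  by (rule Greatest_equality) (use mediated_Union[OF assms] in auto)

lemma mediated_max_mediated:
  assumes "finite \<Delta>" "\<Delta> \<subseteq> even_lattice"
  shows "mediated \<Delta> (max_mediated \<Delta>)"
  using mediated_Union[OF assms] max_mediated_eq_Union[OF assms] by simp

lemma max_mediated_upper:
  assumes "finite \<Delta>" "\<Delta> \<subseteq> even_lattice" "mediated \<Delta> L"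
  shows "L \<subseteq> max_mediated \<Delta>"
  using max_mediated_eq_Union[OF assms(1,2)] assms(3) by blast

lemma max_mediated_bounds:
  assumes "finite \<Delta>" "\<Delta> \<subseteq> even_lattice"
  shows "\<Delta> \<union> Mid \<Delta> \<subseteq> max_mediated \<Delta>"
    and "max_mediated \<Delta> \<subseteq> convex hull \<Delta> \<inter> int_lattice"
proof -
  have "Mid \<Delta> \<subseteq> (\<lambda>(s, t). (1 / 2) *\<^sub>R (s + t)) ` (\<Delta> \<times> \<Delta>)"
    unfolding Mid_def by auto
  then have "finite (Mid \<Delta>)" by (rule finite_subset) (simp add: assms(1))
  then have "mediated \<Delta> (\<Delta> \<union> Mid \<Delta>)"
    using assms even_lattice_subset_int_lattice Mid_subset_int_lattice[of \<Delta>]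
      Mid_mono[of \<Delta> "\<Delta> \<union> Mid \<Delta>"]
    unfolding mediated_def by auto
  then show "\<Delta> \<union> Mid \<Delta> \<subseteq> max_mediated \<Delta>" by (rule max_mediated_upper[OF assms])
  show "max_mediated \<Delta> \<subseteq> convex hull \<Delta> \<inter> int_lattice"
    using mediated_max_mediated[OF assms] mediated_subset_convex_hull unfolding mediated_def by blast
qed

definition mms_preserving :: "(real ^ 'n \<Rightarrow> real ^ 'n) \<Rightarrow> bool" where
  "mms_preserving T \<longleftrightarrow> (\<forall>k \<Delta>. k_simplicial k \<Delta> \<longrightarrow>
     k_simplicial k (T ` \<Delta>) \<and>
     (\<forall>q \<in> max_mediated (T ` \<Delta>). \<exists>!p. p \<in> max_mediated \<Delta> \<and> T p = q) \<and>
     (\<forall>q \<in> convex hull (T ` \<Delta>) \<inter> int_lattice.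
        \<exists>!p. p \<in> convex hull \<Delta> \<inter> int_lattice \<and> T p = q))"

definition unimodular :: "real ^ 'n ^ 'n \<Rightarrow> bool" where
  "unimodular A \<longleftrightarrow> (\<forall>i j. A $ i $ j \<in> \<int>) \<and> (det A = 1 \<or> det A = -1)"

definition even_unimodular_affine :: "(real ^ 'n \<Rightarrow> real ^ 'n) set" where
  "even_unimodular_affine = {T. \<exists>A b. unimodular A \<and> b \<in> even_lattice \<and> (\<forall>x. T x = A *v x + b)}"

definition mms_group :: "(real ^ 'n \<Rightarrow> real ^ 'n) set" where
  "mms_group = {T \<in> even_unimodular_affine. mms_preserving T}"

end

theory Submission
  imports Defs
begin

text \<open>
  A map that agrees with \<open>x \<mapsto> A *v x + b\<close> on integer points, with \<open>A\<close> unimodular and \<open>b\<close> even,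
  is a bijection of the integer lattice and of the even lattice that commutes with convex hulls,
  affine hulls and midpoints. All notions involved in the definition of maximal mediated sets
  are built from these, so the map transports them.

  Conversely let \<open>T\<close> be MMS preserving. Points and segments are simplices of dimension 0 and 1, so
  \<open>T\<close> sends even points to even points and is injective on them. The key is a midpoint argument.
  For two even points the midpoint of their images is an integer point of the image segment, so it is
  the image of an integer point on the original segment. Suppose the direction \<open>v\<close> is an integer
  vector with a coordinate equal to 1. Then the integer points on such a line are the integer
  steps along \<open>v\<close>, so there are few candidates:
  on \<open>[2x, 2x + 2v]\<close> only the midpoint is possible (\<open>mms_midpoint_lattice_step\<close>), and on
  \<open>[2x, 2x + 4v]\<close> the two quarter points are excluded by the first case, so again the midpoint goes
  to the midpoint (\<open>mms_affine_on_even_line\<close>). Thus \<open>T\<close> is affine along such lines of even points.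

  A function on the plane lattice that is affine on all horizontal and all vertical lines has the form
  \<open>\<alpha> + \<beta> a + \<gamma> b + \<delta> a b\<close>, and being affine on diagonals forces \<open>\<delta> = 0\<close>. So the increments of \<open>T\<close> along
  the coordinate directions do not depend on the base point (\<open>mms_parallelogram\<close>), and
  \<open>T\<close> is affine on the even lattice. An integer point with an odd coordinate is the midpoint of two
  even points whose difference is \<open>2v\<close> for a nonzero 0-1 vector \<open>v\<close>, so \<open>T\<close> is affine on the integer
  lattice.

  Finally, an \<open>n\<close>-simplex with even vertices that contains the unit cube has an image of full
  dimension, which makes the linear part surjective over the reals; lifting integer points from the image
  of that simplex makes it surjective over the integers, so it has an integer right inverse and
  its determinant is \<open>1\<close> or \<open>-1\<close> (\<open>unimodular_linear_part\<close>).
\<close>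

section \<open>Integer and even lattice points\<close>

lemma even_lattice_iff: "x \<in> even_lattice \<longleftrightarrow> (\<exists>y\<in>int_lattice. x = 2 *\<^sub>R y)"
proof
  assume "x \<in> even_lattice"
  then have "\<forall>i. \<exists>m::int. x $ i = 2 * of_int m" by (simp add: even_lattice_def)
  then have "(1/2) *\<^sub>R x \<in> int_lattice"
    unfolding int_lattice_def by (auto intro: Ints_of_int) (metis Ints_of_int nonzero_mult_div_cancel_left zero_neq_numeral)
  moreover have "x = 2 *\<^sub>R ((1/2) *\<^sub>R x)" by simp
  ultimately show "\<exists>y\<in>int_lattice. x = 2 *\<^sub>R y" by blast
next
  assume "\<exists>y\<in>int_lattice. x = 2 *\<^sub>R y"
  then show "x \<in> even_lattice"
    unfolding int_lattice_def even_lattice_def by (auto elim!: Ints_cases) (metis Ints_cases)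
qed

lemma double_in_even_lattice: "y \<in> int_lattice \<Longrightarrow> 2 *\<^sub>R y \<in> even_lattice"
  using even_lattice_iff by blast

lemma int_lattice_add: "x \<in> int_lattice \<Longrightarrow> y \<in> int_lattice \<Longrightarrow> x + y \<in> int_lattice"
  and int_lattice_diff: "x \<in> int_lattice \<Longrightarrow> y \<in> int_lattice \<Longrightarrow> x - y \<in> int_lattice"
  and int_lattice_scaleR: "c \<in> \<int> \<Longrightarrow> x \<in> int_lattice \<Longrightarrow> c *\<^sub>R x \<in> int_lattice"
  and int_lattice_zero: "0 \<in> int_lattice"
  and int_lattice_axis: "axis i 1 \<in> int_lattice"
  by (simp_all add: int_lattice_def axis_def)

lemma even_lattice_midpoint:
  assumes "x \<in> even_lattice" "y \<in> even_lattice"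
  shows "midpoint x y \<in> int_lattice"
proof -
  obtain u v where "u \<in> int_lattice" "v \<in> int_lattice" "x = 2 *\<^sub>R u" "y = 2 *\<^sub>R v"
    using assms by (auto simp: even_lattice_iff)
  then show ?thesis by (simp add: midpoint_def int_lattice_add flip: scaleR_add_right)
qed

text \<open>
  The step is an equivalence, so that it also descends in the coordinate directions and no separate
  case for subtraction is needed. Each coordinate is handled by integer induction, and the
  coordinates are filled in one after the other.
\<close>

lemma int_lattice_induct [consumes 1, case_names zero step]:
  fixes x :: "real ^ 'n"
  assumes "x \<in> int_lattice" "P 0"
    and step: "\<And>y i. y \<in> int_lattice \<Longrightarrow> P (y + axis i 1) \<longleftrightarrow> P y"
  shows "P x"
proof -
  have shift: "P (y + of_int m *\<^sub>R axis i 1) \<longleftrightarrow> P y" if y: "y \<in> int_lattice" for y m i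
  proof (induction m rule: int_induct[where k = 0])
    case (step1 m)
    have "P ((y + of_int m *\<^sub>R axis i 1) + axis i 1) \<longleftrightarrow> P (y + of_int m *\<^sub>R axis i 1)"
      by (intro step int_lattice_add int_lattice_scaleR int_lattice_axis y) simp
    then show ?case using step1 by (simp add: algebra_simps)
  next
    case (step2 m)
    have "P ((y + of_int (m - 1) *\<^sub>R axis i 1) + axis i 1) \<longleftrightarrow> P (y + of_int (m - 1) *\<^sub>R axis i 1)"
      by (intro step int_lattice_add int_lattice_scaleR int_lattice_axis y) simp
    then show ?case using step2 by (simp add: algebra_simps)
  qed simp
  have partial: "(\<Sum>i\<in>S. (x $ i) *\<^sub>R axis i 1) \<in> int_lattice \<and> P (\<Sum>i\<in>S. (x $ i) *\<^sub>R axis i 1)"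
    if "finite S" for S
    using that
  proof (induction S rule: finite_induct)
    case (insert i S)
    obtain m where m: "x $ i = of_int m" using assms(1) by (auto simp: int_lattice_def elim: Ints_cases)
    then show ?case using insert shift[of "\<Sum>i\<in>S. (x $ i) *\<^sub>R axis i 1" m i]
      by (simp add: add.commute int_lattice_add int_lattice_scaleR int_lattice_axis)
  qed (simp add: int_lattice_zero assms(2))
  have "(\<Sum>i\<in>UNIV. (x $ i) *\<^sub>R axis i 1) = x"
    using basis_expansion[of x] by (simp add: scalar_mult_eq_scaleR)
  then show ?thesis using partial[of UNIV] by simp
qed

section \<open>Integer matrices\<close>

lemma det_Ints:
  fixes A :: "real ^ 'n ^ 'n"
  assumes "\<And>i j. A $ i $ j \<in> \<int>"
  shows "det A \<in> \<int>"
  unfolding det_def by (intro Ints_sum Ints_mult Ints_prod assms) simp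

lemma matrix_vector_int_lattice:
  fixes A :: "real ^ 'n ^ 'm"
  assumes "\<And>i j. A $ i $ j \<in> \<int>" "x \<in> int_lattice"
  shows "A *v x \<in> int_lattice"
  using assms by (auto simp: int_lattice_def matrix_vector_mult_def intro!: Ints_sum Ints_mult)

text \<open>
  Cramer's rule: every coordinate of the solution is a quotient of an integer determinant by \<open>1\<close> or \<open>-1\<close>.
\<close>

lemma unimodular_int_preimage:
  assumes "unimodular A" "A *v x \<in> int_lattice"
  shows "x \<in> int_lattice"
proof -
  have d: "det A \<noteq> 0" "det A = 1 \<or> det A = -1" and int: "\<And>i j. A $ i $ j \<in> \<int>"
    using assms(1) by (auto simp: unimodular_def)
  define C where "C k = (\<chi> i j. if j = k then (A *v x) $ i else A $ i $ j)" for k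
  have "x = (\<chi> k. det (C k) / det A)"
    unfolding C_def using cramer[OF d(1), of x "A *v x"] by simp
  moreover have "det (C k) \<in> \<int>" for k
    by (rule det_Ints) (use assms(2) int in \<open>auto simp: C_def int_lattice_def\<close>)
  ultimately show ?thesis using d(2) by (auto simp: int_lattice_def vec_eq_iff)
qed

text \<open>
  Integer solutions of \<open>A *v p = e\<close> for the unit vectors \<open>e\<close> are the columns of an integer right inverse,
  so the two determinants are integers with product 1.
\<close>

lemma unimodular_if_onto:
  fixes A :: "real ^ 'n ^ 'n"
  assumes int: "\<And>i j. A $ i $ j \<in> \<int>"
    and onto: "\<And>q. q \<in> int_lattice \<Longrightarrow> \<exists>p\<in>int_lattice. A *v p = q"
  shows "unimodular A"
proof -
  have "\<forall>i. \<exists>p\<in>int_lattice. A *v p = axis i 1" using onto int_lattice_axis by blast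
  then obtain p where p: "\<And>i. p i \<in> int_lattice" "\<And>i. A *v p i = axis i 1" by metis
  define B where "B = (\<chi> r i. p i $ r)"
  have "A ** B = mat 1"
  proof -
    have "(A ** B) $ r $ i = (A *v p i) $ r" for r i
      by (simp add: matrix_matrix_mult_def matrix_vector_mult_def B_def)
    then show ?thesis by (simp add: p(2) vec_eq_iff axis_def mat_def)
  qed
  then have "det A * det B = 1" by (metis det_mul det_I)
  moreover have "det A \<in> \<int>" "det B \<in> \<int>"
    using det_Ints int p(1) by (auto simp: B_def int_lattice_def intro!: det_Ints)
  then obtain a b where "det A = of_int a" "det B = of_int b" by (auto elim!: Ints_cases)
  ultimately have "a * b = 1" "det A = of_int a" by (simp_all flip: of_int_mult)
  then show ?thesis using int zmult_eq_1_iff[of a b] by (auto simp: unimodular_def)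
qed

section \<open>Even unimodular affine maps preserve maximal mediated sets\<close>

lemma matrix_affine_midpoint: "A *v midpoint s t + b = midpoint (A *v s + b) (A *v t + b)"
  for A :: "real ^ 'n ^ 'm"
  by (simp add: midpoint_def matrix_vector_right_distrib matrix_vector_mult_scaleR vec_eq_iff field_simps)

lemma image_matrix_affine: "(\<lambda>x. A *v x + b) ` S = (+) b ` ((*v) A ` S)"
  for A :: "real ^ 'n ^ 'm"
  by (simp add: image_image add.commute)

lemma convex_hull_matrix_affine:
  "convex hull ((\<lambda>x. A *v x + b) ` S) = (\<lambda>x. A *v x + b) ` (convex hull S)"
  for A :: "real ^ 'n ^ 'm"
  unfolding image_matrix_affine convex_hull_translation
  by (subst convex_hull_linear_image) simp_all

lemma affine_hull_matrix_affine:
  "affine hull ((\<lambda>x. A *v x + b) ` S) = (\<lambda>x. A *v x + b) ` (affine hull S)"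
  for A :: "real ^ 'n ^ 'm"
  unfolding image_matrix_affine affine_hull_translation
  by (subst affine_hull_linear_image) (simp_all add: matrix_vector_mul_bounded_linear)

lemma Mid_eq: "Mid L = {midpoint s t | s t. s \<in> L \<inter> even_lattice \<and> t \<in> L \<inter> even_lattice \<and> s \<noteq> t}"
  by (simp add: Mid_def midpoint_def)

locale even_unimodular_map =
  fixes A :: "real ^ 'n ^ 'n" and b :: "real ^ 'n"
  assumes A: "unimodular A" and b: "b \<in> even_lattice"
begin

definition F :: "real ^ 'n \<Rightarrow> real ^ 'n" where "F x = A *v x + b"

lemma F_abs: "(\<lambda>x. A *v x + b) = F" by (simp add: fun_eq_iff F_def)

lemma F_inj: "inj F"
proof -
  have "det A \<noteq> 0" using A by (auto simp: unimodular_def)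
  then have "inj ((*v) A)" by (simp add: invertible_det_nz inj_matrix_vector_mult)
  then show ?thesis by (auto simp: inj_def F_def)
qed

lemma F_surj: "surj F"
proof -
  have "det A \<noteq> 0" using A by (auto simp: unimodular_def)
  then obtain B where "A ** B = mat 1" by (auto simp: invertible_det_nz[symmetric] invertible_def)
  then have "F (B *v (y - b)) = y" for y by (simp add: F_def matrix_vector_mul_assoc)
  then show ?thesis by (rule surjI)
qed

lemma F_int_lattice: "F x \<in> int_lattice \<longleftrightarrow> x \<in> int_lattice"
proof -
  have b': "b \<in> int_lattice" using b even_lattice_subset_int_lattice by blast
  have "F x \<in> int_lattice \<longleftrightarrow> A *v x \<in> int_lattice"
    using int_lattice_add[OF _ b'] int_lattice_diff[OF _ b'] unfolding F_def
    by (metis add_diff_cancel_right')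
  then show ?thesis
    using unimodular_int_preimage[OF A] matrix_vector_int_lattice A by (auto simp: unimodular_def)
qed

text \<open>
  Halving reduces this to integrality of \<open>A *v ((1/2) *\<^sub>R x) + (1/2) *\<^sub>R b\<close>; this is where \<open>b\<close> has to be
  even and not just integral.
\<close>

lemma F_even_lattice: "F x \<in> even_lattice \<longleftrightarrow> x \<in> even_lattice"
proof -
  obtain c where c: "c \<in> int_lattice" "b = 2 *\<^sub>R c" using b even_lattice_iff by blast
  have half: "y \<in> even_lattice \<longleftrightarrow> (1/2) *\<^sub>R y \<in> int_lattice" for y :: "real ^ 'n"
  proof -
    have "y = 2 *\<^sub>R z \<longleftrightarrow> (1/2) *\<^sub>R y = z" for z by auto
    then show ?thesis by (simp add: even_lattice_iff)
  qed
  have "(1/2) *\<^sub>R F x = A *v ((1/2) *\<^sub>R x) + c"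
    by (simp add: F_def c(2)[symmetric] matrix_vector_mult_scaleR scaleR_add_right) (simp add: c(2))
  then have "F x \<in> even_lattice \<longleftrightarrow> A *v ((1/2) *\<^sub>R x) \<in> int_lattice"
    unfolding half using int_lattice_add[OF _ c(1)] int_lattice_diff[OF _ c(1)]
    by (metis add_diff_cancel_right')
  also have "\<dots> \<longleftrightarrow> (1/2) *\<^sub>R x \<in> int_lattice"
    using unimodular_int_preimage[OF A] matrix_vector_int_lattice A by (auto simp: unimodular_def)
  finally show ?thesis by (simp add: half)
qed

lemma Mid_image: "Mid (F ` L) = F ` Mid L"
proof
  have F_mid: "F (midpoint s t) = midpoint (F s) (F t)" for s t
    by (simp add: F_def matrix_affine_midpoint)
  show "F ` Mid L \<subseteq> Mid (F ` L)"
  proof clarify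
    fix x assume "x \<in> Mid L"
    then obtain s t where "x = midpoint s t" "s \<in> L" "t \<in> L" "s \<in> even_lattice" "t \<in> even_lattice" "s \<noteq> t"
      by (auto simp: Mid_eq)
    then have "F x = midpoint (F s) (F t)" "F s \<in> F ` L \<inter> even_lattice" "F t \<in> F ` L \<inter> even_lattice" "F s \<noteq> F t"
      by (auto simp: F_mid F_even_lattice inj_eq[OF F_inj])
    then show "F x \<in> Mid (F ` L)" unfolding Mid_eq by blast
  qed
  show "Mid (F ` L) \<subseteq> F ` Mid L"
  proof
    fix y assume "y \<in> Mid (F ` L)"
    then obtain s t where "y = midpoint (F s) (F t)" "s \<in> L" "t \<in> L"
      "F s \<in> even_lattice" "F t \<in> even_lattice" "F s \<noteq> F t"
      by (auto simp: Mid_eq)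
    then have "y = F (midpoint s t)" "s \<in> L \<inter> even_lattice" "t \<in> L \<inter> even_lattice" "s \<noteq> t"
      by (auto simp: F_mid F_even_lattice)
    then show "y \<in> F ` Mid L" unfolding Mid_eq by blast
  qed
qed

lemma mediated_image: "mediated (F ` \<Delta>) (F ` L) \<longleftrightarrow> mediated \<Delta> L"
proof -
  have "F ` L \<subseteq> int_lattice \<longleftrightarrow> L \<subseteq> int_lattice" using F_int_lattice by blast
  moreover have "F ` L \<subseteq> Mid (F ` L) \<union> F ` \<Delta> \<longleftrightarrow> L \<subseteq> Mid L \<union> \<Delta>"
    by (simp add: Mid_image inj_image_subset_iff[OF F_inj] flip: image_Un)
  ultimately show ?thesis
    by (simp add: mediated_def inj_image_subset_iff[OF F_inj] finite_image_iff inj_on_subset[OF F_inj])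
qed

text \<open>
  The preimage under the bijection \<open>F\<close> turns mediated sets of the image back into mediated sets,
  so \<open>F\<close> matches the two families whose unions are the maximal mediated sets.
\<close>

lemma max_mediated_image:
  assumes "finite \<Delta>" "\<Delta> \<subseteq> even_lattice"
  shows "max_mediated (F ` \<Delta>) = F ` max_mediated \<Delta>"
proof -
  have "F ` \<Delta> \<subseteq> even_lattice" using assms F_even_lattice by blast
  then have "max_mediated (F ` \<Delta>) = \<Union>{M. mediated (F ` \<Delta>) M}"
    by (intro max_mediated_eq_Union finite_imageI assms)
  also have "{M. mediated (F ` \<Delta>) M} = (`) F ` {L. mediated \<Delta> L}"
  proof -
    have "M \<in> (`) F ` {L. mediated \<Delta> L}" if "mediated (F ` \<Delta>) M" for M
    proof
      show M: "M = F ` (F -` M)" by (rule surj_image_vimage_eq[OF F_surj, symmetric])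
      have "mediated (F ` \<Delta>) (F ` (F -` M))" using that by (simp only: M[symmetric])
      then show "F -` M \<in> {L. mediated \<Delta> L}" by (simp only: mediated_image mem_Collect_eq)
    qed
    then show ?thesis by (auto simp only: mediated_image mem_Collect_eq)
  qed
  also have "\<Union> \<dots> = F ` max_mediated \<Delta>" by (simp add: max_mediated_eq_Union[OF assms] image_Union)
  finally show ?thesis .
qed

lemma k_simplicial_image:
  assumes "k_simplicial k \<Delta>"
  shows "k_simplicial k (F ` \<Delta>)"
proof -
  have "F ` \<Delta> - {F x} = F ` (\<Delta> - {x})" for x using F_inj by (auto simp: inj_eq)
  then have "affine_dependent (F ` \<Delta>) \<longleftrightarrow> affine_dependent \<Delta>"
    by (simp add: affine_dependent_def affine_hull_matrix_affine[of A b, unfolded F_abs] inj_image_mem_iff[OF F_inj])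
  moreover have "card (F ` \<Delta>) = card \<Delta>"
    by (rule card_image) (rule inj_on_subset[OF F_inj], simp)
  ultimately show ?thesis using assms F_even_lattice by (auto simp: k_simplicial_iff)
qed

text \<open>
  Only the values of \<open>T\<close> at integer points enter the definition of MMS preserving, so agreement
  with \<open>F\<close> there is enough.
\<close>

lemma mms_preserving_if_eq_on_int_lattice:
  assumes T: "\<And>x. x \<in> int_lattice \<Longrightarrow> T x = F x"
  shows "mms_preserving T"
  unfolding mms_preserving_def
proof (intro allI impI)
  fix k and \<Delta> :: "(real ^ 'n) set"
  assume D: "k_simplicial k \<Delta>"
  then have ev: "finite \<Delta>" "\<Delta> \<subseteq> even_lattice" by (auto simp: k_simplicial_def)
  have T_D: "T ` \<Delta> = F ` \<Delta>" using ev even_lattice_subset_int_lattice T by (intro image_cong) auto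
  have bij: "\<exists>!p. p \<in> S \<and> T p = q" if S: "S \<subseteq> int_lattice" and q: "q \<in> F ` S" for S q
  proof -
    obtain p where p: "p \<in> S" "q = F p" using q by blast
    have TF: "T p' = F p'" if "p' \<in> S" for p' using T subsetD[OF S that] .
    show ?thesis
    proof (rule ex1I[of _ p])
      show "p \<in> S \<and> T p = q" using p TF by simp
      show "p' = p" if "p' \<in> S \<and> T p' = q" for p'
        by (rule injD[OF F_inj]) (use that p TF[of p'] in simp)
    qed
  qed
  have hull: "F ` (convex hull \<Delta> \<inter> int_lattice) = convex hull (F ` \<Delta>) \<inter> int_lattice"
    using F_int_lattice by (auto simp: convex_hull_matrix_affine[of A b, unfolded F_abs])
  have sub: "max_mediated \<Delta> \<subseteq> int_lattice" using max_mediated_bounds(2)[OF ev] by blast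
  show "k_simplicial k (T ` \<Delta>) \<and>
     (\<forall>q \<in> max_mediated (T ` \<Delta>). \<exists>!p. p \<in> max_mediated \<Delta> \<and> T p = q) \<and>
     (\<forall>q \<in> convex hull (T ` \<Delta>) \<inter> int_lattice.
        \<exists>!p. p \<in> convex hull \<Delta> \<inter> int_lattice \<and> T p = q)"
    unfolding T_D max_mediated_image[OF ev] hull[symmetric]
    by (intro conjI ballI k_simplicial_image[OF D] bij sub Int_lower2)
qed

end

section \<open>Midpoints on lattice lines\<close>

text \<open>
  A coordinate of \<open>v\<close> equal to 1 makes the parameter along the line readable as a difference of
  coordinates, hence an integer. This special kind of primitive vector covers all directions needed
  below: unit vectors, sums of two of them, and nonzero 0-1 vectors.
\<close>

lemma int_points_of_segment:
  fixes x v :: "real ^ 'n"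
  assumes x: "x \<in> int_lattice" and v: "v $ i = 1"
    and p: "p \<in> closed_segment x (x + of_nat N *\<^sub>R v)" "p \<in> int_lattice"
  shows "\<exists>k\<le>N. p = x + of_nat k *\<^sub>R v"
proof -
  obtain u where u: "0 \<le> u" "u \<le> 1" "p = x + (u * of_nat N) *\<^sub>R v"
    using p(1) by (auto simp: in_segment algebra_simps)
  have "u * of_nat N = p $ i - x $ i" using u(3) v by simp
  then have "u * of_nat N \<in> \<int>" using x p(2) by (simp add: int_lattice_def)
  moreover have "0 \<le> u * of_nat N" "u * of_nat N \<le> of_nat N"
    using u mult_right_mono[of u 1 "of_nat N"] by auto
  ultimately obtain m :: int where "u * of_nat N = of_int m" "0 \<le> m" "m \<le> int N"
    by (auto elim!: Ints_cases)
  then have "u * of_nat N = of_nat (nat m)" "nat m \<le> N" by simp_all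
  then show ?thesis using u(3) by auto
qed

context
  fixes T :: "real ^ 'n \<Rightarrow> real ^ 'n"
  assumes mms: "mms_preserving T"
begin

lemma mms_simplicial_image: "k_simplicial k \<Delta> \<Longrightarrow> k_simplicial k (T ` \<Delta>)"
  using mms by (simp only: mms_preserving_def)

lemma mms_hull_lift:
  assumes "k_simplicial k \<Delta>" "q \<in> convex hull (T ` \<Delta>)" "q \<in> int_lattice"
  shows "\<exists>p\<in>convex hull \<Delta> \<inter> int_lattice. T p = q"
proof -
  have "\<forall>q \<in> convex hull (T ` \<Delta>) \<inter> int_lattice.
        \<exists>!p. p \<in> convex hull \<Delta> \<inter> int_lattice \<and> T p = q"
    using mms[unfolded mms_preserving_def, THEN spec, THEN spec, THEN mp, OF assms(1)] by (elim conjE)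
  then show ?thesis using assms(2,3) by blast
qed

lemma mms_even_lattice: "x \<in> even_lattice \<Longrightarrow> T x \<in> even_lattice"
proof -
  assume "x \<in> even_lattice"
  then have "k_simplicial 0 {x}" by (simp add: k_simplicial_iff)
  then have "k_simplicial 0 (T ` {x})" by (rule mms_simplicial_image)
  then show ?thesis by (simp add: k_simplicial_iff)
qed

lemma mms_segment:
  assumes "x \<in> even_lattice" "y \<in> even_lattice" "x \<noteq> y"
  shows "T x \<noteq> T y"
    and "\<exists>p\<in>closed_segment x y \<inter> int_lattice. T p = midpoint (T x) (T y)"
proof -
  have D: "k_simplicial 1 {x, y}" using assms by (simp add: k_simplicial_iff)
  then have "k_simplicial 1 (T ` {x, y})" by (rule mms_simplicial_image)
  then have "card {T x, T y} = 2" by (simp add: k_simplicial_iff)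
  then show "T x \<noteq> T y" by auto
  have "midpoint (T x) (T y) \<in> convex hull (T ` {x, y}) \<inter> int_lattice"
    using even_lattice_midpoint[OF mms_even_lattice[OF assms(1)] mms_even_lattice[OF assms(2)]]
    by (simp flip: segment_convex_hull)
  then show "\<exists>p\<in>closed_segment x y \<inter> int_lattice. T p = midpoint (T x) (T y)"
    using mms_hull_lift[OF D] by (auto simp: segment_convex_hull)
qed

text \<open>
  The only integer points of the segment are its end points and its midpoint. Some integer point
  is sent to the midpoint of the images, and it cannot be an end point because the images of the end points are
  distinct.
\<close>

lemma mms_midpoint_lattice_step:
  assumes x: "x \<in> int_lattice" and v: "v \<in> int_lattice" "v $ i = 1"
  shows "T (2 *\<^sub>R x + v) = midpoint (T (2 *\<^sub>R x)) (T (2 *\<^sub>R x + 2 *\<^sub>R v))"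
proof -
  have ev: "2 *\<^sub>R x \<in> even_lattice" "2 *\<^sub>R x + 2 *\<^sub>R v \<in> even_lattice"
    using x v by (auto intro: double_in_even_lattice int_lattice_add simp flip: scaleR_add_right)
  have "v \<noteq> 0" using v by auto
  then have ne: "2 *\<^sub>R x \<noteq> 2 *\<^sub>R x + 2 *\<^sub>R v" by simp
  note seg = mms_segment[OF ev ne]
  obtain p where p: "p \<in> closed_segment (2 *\<^sub>R x) (2 *\<^sub>R x + 2 *\<^sub>R v)" "p \<in> int_lattice"
    "T p = midpoint (T (2 *\<^sub>R x)) (T (2 *\<^sub>R x + 2 *\<^sub>R v))" using seg(2) by blast
  obtain k :: nat where k: "k \<le> 2" "p = 2 *\<^sub>R x + of_nat k *\<^sub>R v"
    using int_points_of_segment[of "2 *\<^sub>R x" v i p 2] p x v even_lattice_subset_int_lattice ev by auto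
  from k(1) consider "k = 0" | "k = 1" | "k = 2" by linarith
  then show ?thesis
  proof cases
    case 1 then show ?thesis using p(3) seg(1) k(2) by (metis add.right_neutral midpoint_eq_endpoint(1) of_nat_0 scaleR_zero_left)
  next
    case 2 then show ?thesis using p(3) k(2) by simp
  next
    case 3 then show ?thesis using p(3) seg(1) k(2) by (metis midpoint_eq_endpoint(2) of_nat_numeral)
  qed
qed

text \<open>
  Of the five integer points on the segment one is sent to the midpoint of the images of the ends.
  It is not an end point, and not a quarter point either: a quarter point is already known to go to the
  midpoint of the images of the centre and of one end, and these images are pairwise
  distinct. So it is the centre.
\<close>

lemma mms_affine_on_even_line:
  assumes x: "x \<in> int_lattice" and v: "v \<in> int_lattice" "v $ i = 1"
  shows "T (2 *\<^sub>R (x + 2 *\<^sub>R v)) = 2 *\<^sub>R T (2 *\<^sub>R (x + v)) - T (2 *\<^sub>R x)"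
proof -
  define a c d where "a = T (2 *\<^sub>R x)" and "c = T (2 *\<^sub>R (x + v))" and "d = T (2 *\<^sub>R (x + 2 *\<^sub>R v))"
  have ev: "2 *\<^sub>R x \<in> even_lattice" "2 *\<^sub>R (x + v) \<in> even_lattice" "2 *\<^sub>R (x + 2 *\<^sub>R v) \<in> even_lattice"
    using x v by (auto intro!: double_in_even_lattice int_lattice_add int_lattice_scaleR)
  have "(2 *\<^sub>R x) $ i \<noteq> (2 *\<^sub>R (x + v)) $ i" "(2 *\<^sub>R (x + v)) $ i \<noteq> (2 *\<^sub>R (x + 2 *\<^sub>R v)) $ i"
    "(2 *\<^sub>R x) $ i \<noteq> (2 *\<^sub>R (x + 2 *\<^sub>R v)) $ i"
    using v by simp_all
  then have distinct: "2 *\<^sub>R x \<noteq> 2 *\<^sub>R (x + v)" "2 *\<^sub>R (x + v) \<noteq> 2 *\<^sub>R (x + 2 *\<^sub>R v)"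
    "2 *\<^sub>R x \<noteq> 2 *\<^sub>R (x + 2 *\<^sub>R v)" by metis+
  then have ne: "a \<noteq> c" "c \<noteq> d" "a \<noteq> d"
    unfolding a_def c_def d_def by (intro mms_segment(1) ev distinct)+
  then obtain p where p: "p \<in> closed_segment (2 *\<^sub>R x) (2 *\<^sub>R (x + 2 *\<^sub>R v))" "p \<in> int_lattice"
    "T p = midpoint a d" using mms_segment(2)[OF ev(1,3) distinct(3)] unfolding a_def d_def by blast
  have "2 *\<^sub>R (x + 2 *\<^sub>R v) = 2 *\<^sub>R x + of_nat 4 *\<^sub>R v" by (simp add: algebra_simps)
  then obtain k :: nat where k: "k \<le> 4" "p = 2 *\<^sub>R x + of_nat k *\<^sub>R v"
    using int_points_of_segment[of "2 *\<^sub>R x" v i p 4] p x v even_lattice_subset_int_lattice ev by auto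
  \<comment> \<open>The two quarter points are centres of segments of the form \<open>[y, y + 2v]\<close>.\<close>
  have quarter: "T (2 *\<^sub>R x + v) = midpoint a c"
    using mms_midpoint_lattice_step[OF x v] by (simp add: a_def c_def scaleR_add_right)
  have "T (2 *\<^sub>R (x + v) + v) = midpoint c (T (2 *\<^sub>R (x + v) + 2 *\<^sub>R v))"
    unfolding c_def by (rule mms_midpoint_lattice_step[OF int_lattice_add[OF x v(1)] v])
  moreover have "2 *\<^sub>R (x + v) + 2 *\<^sub>R v = 2 *\<^sub>R (x + 2 *\<^sub>R v)" "2 *\<^sub>R (x + v) + v = 2 *\<^sub>R x + of_nat 3 *\<^sub>R v"
    by (simp_all add: vec_eq_iff algebra_simps)
  ultimately have three_quarters: "T (2 *\<^sub>R x + of_nat 3 *\<^sub>R v) = midpoint c d" by (simp add: d_def)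
  from k(1) consider "k = 0" | "k = 1" | "k = 2" | "k = 3" | "k = 4" by linarith
  then have "midpoint a d = c"
  proof cases
    case 1
    then have "T p = a" using k(2) by (simp add: a_def)
    then have "midpoint a d = a" using p(3) by simp
    then show ?thesis using ne by (simp add: midpoint_eq_endpoint)
  next
    case 2 then show ?thesis using p(3) k(2) ne quarter by (simp add: midpoint_def)
  next
    case 3 then show ?thesis using p(3) k(2) by (simp add: c_def scaleR_add_right)
  next
    case 4 then show ?thesis using p(3) k(2) ne three_quarters by (simp add: midpoint_def)
  next
    case 5
    then have "T p = d" using k(2) by (simp add: d_def scaleR_add_right)
    then show ?thesis using p(3) ne by (simp add: midpoint_eq_endpoint)
  qed
  then have "2 *\<^sub>R c = a + d" by (auto simp: midpoint_def)
  then show ?thesis by (simp add: a_def c_def d_def)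
qed

section \<open>From lattice lines to the whole lattice\<close>

text \<open>
  On the nine points \<open>x + a u + b v\<close> with \<open>a, b \<le> 2\<close>, the far corner \<open>x + 2u + 2v\<close> is determined by the
  four points with \<open>a, b \<le> 1\<close> in two ways: along lines in the directions \<open>u\<close> and \<open>v\<close>, and along the
  diagonal. Comparing the two values leaves the parallelogram identity.
\<close>

lemma mms_parallelogram:
  assumes x: "x \<in> int_lattice"
  shows "T (2 *\<^sub>R (x + axis j 1 + axis i 1)) - T (2 *\<^sub>R (x + axis j 1))
       = T (2 *\<^sub>R (x + axis i 1)) - T (2 *\<^sub>R x)"
proof (cases "i = j")
  case True
  have "T (2 *\<^sub>R (x + 2 *\<^sub>R axis j 1)) = 2 *\<^sub>R T (2 *\<^sub>R (x + axis j 1)) - T (2 *\<^sub>R x)"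
    by (rule mms_affine_on_even_line[where i = j, OF x int_lattice_axis]) simp
  then show ?thesis using True by (simp add: scaleR_2 add.assoc)
next
  case False
  define g where "g y = T (2 *\<^sub>R y)" for y
  define u v :: "real ^ 'n" where "u = axis i 1" and "v = axis j 1"
  have uv: "u \<in> int_lattice" "v \<in> int_lattice" "u + v \<in> int_lattice" "u $ i = 1" "v $ j = 1" "(u + v) $ i = 1"
    using False by (auto simp: u_def v_def int_lattice_add int_lattice_axis) (simp add: axis_def)
  note line = mms_affine_on_even_line[folded g_def]
  have "g (x + 2 *\<^sub>R u) = 2 *\<^sub>R g (x + u) - g x" by (rule line[OF x uv(1,4)])
  moreover have "g (x + v + 2 *\<^sub>R u) = 2 *\<^sub>R g (x + v + u) - g (x + v)"
    by (rule line[OF int_lattice_add[OF x uv(2)] uv(1,4)])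
  moreover have "g (x + 2 *\<^sub>R u + 2 *\<^sub>R v) = 2 *\<^sub>R g (x + 2 *\<^sub>R u + v) - g (x + 2 *\<^sub>R u)"
    by (intro line[OF _ uv(2,5)] int_lattice_add x int_lattice_scaleR uv(1)) simp
  moreover have "g (x + 2 *\<^sub>R (u + v)) = 2 *\<^sub>R g (x + (u + v)) - g x" by (rule line[OF x uv(3,6)])
  moreover have "x + 2 *\<^sub>R (u + v) = x + 2 *\<^sub>R u + 2 *\<^sub>R v" "x + v + 2 *\<^sub>R u = x + 2 *\<^sub>R u + v"
    "x + (u + v) = x + v + u" by (simp_all add: algebra_simps)
  \<comment> \<open>Both sides are the value of \<open>g\<close> at \<open>x + 2u + 2v\<close>.\<close>
  ultimately have "2 *\<^sub>R g (x + v + u) - g x = 2 *\<^sub>R (2 *\<^sub>R g (x + v + u) - g (x + v)) - (2 *\<^sub>R g (x + u) - g x)"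
    by (metis add.assoc add.commute)
  then have "(2 *\<^sub>R g (x + v + u) - g x) $ r
      = (2 *\<^sub>R (2 *\<^sub>R g (x + v + u) - g (x + v)) - (2 *\<^sub>R g (x + u) - g x)) $ r" for r
    by (rule arg_cong)
  then have "g (x + v + u) $ r - g (x + v) $ r = g (x + u) $ r - g x $ r" for r
    by (drule_tac x = r in meta_spec) (simp add: field_simps)
  then have "g (x + v + u) - g (x + v) = g (x + u) - g x" by (simp add: vec_eq_iff)
  then show ?thesis by (simp only: g_def u_def v_def)
qed

lemma mms_axis_increment:
  assumes "x \<in> int_lattice"
  shows "T (2 *\<^sub>R (x + axis i 1)) - T (2 *\<^sub>R x) = T (2 *\<^sub>R axis i 1) - T 0"
  using assms
proof (induction rule: int_lattice_induct)
  case (step y j)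
  then show ?case using mms_parallelogram[OF step, of j i] by simp
qed simp

text \<open>
  The columns are half the increments of \<open>T\<close> along the even lattice, since an increment belongs to a
  step of length 2.
\<close>

definition linear_part :: "real ^ 'n ^ 'n" where
  "linear_part = (\<chi> r i. (T (2 *\<^sub>R axis i 1) $ r - T 0 $ r) / 2)"

lemma linear_part_axis: "2 *\<^sub>R (linear_part *v axis i 1) = T (2 *\<^sub>R axis i 1) - T 0"
  by (simp add: matrix_vector_mult_basis column_def linear_part_def vec_eq_iff)

lemma mms_zero_even: "T 0 \<in> even_lattice"
  using mms_even_lattice[of 0] double_in_even_lattice[OF int_lattice_zero] by simp

lemma linear_part_Ints: "linear_part $ r $ i \<in> \<int>"
proof -
  have "T (2 *\<^sub>R axis i 1) \<in> even_lattice"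
    by (intro mms_even_lattice double_in_even_lattice int_lattice_axis)
  then obtain k m :: int where "T (2 *\<^sub>R axis i 1) $ r = 2 * of_int k" "T 0 $ r = 2 * of_int m"
    using mms_zero_even unfolding even_lattice_def by blast
  then have "linear_part $ r $ i = of_int (k - m)" by (simp add: linear_part_def)
  then show ?thesis by (metis Ints_of_int)
qed

lemma mms_affine_on_even_lattice:
  assumes "x \<in> int_lattice"
  shows "T (2 *\<^sub>R x) = linear_part *v (2 *\<^sub>R x) + T 0"
  using assms
proof (induction rule: int_lattice_induct)
  case (step y i)
  have swap: "p - r = q - s" if "p - q = d" "r - s = d" for p q r s d :: "real ^ 'n"
    using that by (simp add: algebra_simps)
  have "linear_part *v (2 *\<^sub>R (y + axis i 1)) - linear_part *v (2 *\<^sub>R y) = T (2 *\<^sub>R axis i 1) - T 0"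
    by (simp add: matrix_vector_right_distrib matrix_vector_mult_scaleR scaleR_add_right linear_part_axis)
  then have "T (2 *\<^sub>R (y + axis i 1)) - linear_part *v (2 *\<^sub>R (y + axis i 1))
      = T (2 *\<^sub>R y) - linear_part *v (2 *\<^sub>R y)"
    using swap mms_axis_increment[OF step, of i] by metis
  then show ?case by (metis add.commute diff_eq_eq)
qed simp

text \<open>
  Subtracting the vector of parities leaves an even point, so an integer point \<open>z\<close> is \<open>2x + v\<close> with a
  0-1 vector \<open>v\<close>, which is the midpoint of the even points \<open>2x\<close> and \<open>2(x + v)\<close>. A nonzero \<open>v\<close>
  has a coordinate 1, so the midpoint is preserved.
\<close>

lemma mms_affine_on_int_lattice:
  assumes z: "z \<in> int_lattice"
  shows "T z = linear_part *v z + T 0"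
proof -
  define v :: "real ^ 'n" where "v = (\<chi> i. if even \<lfloor>z $ i\<rfloor> then 0 else 1)"
  define x where "x = (1/2) *\<^sub>R (z - v)"
  have z_eq: "z = 2 *\<^sub>R x + v" by (simp add: x_def)
  have v: "v \<in> int_lattice" by (simp add: v_def int_lattice_def)
  have x: "x \<in> int_lattice"
  proof -
    have "x $ i \<in> \<int>" for i
    proof -
      obtain m where m: "z $ i = of_int m" using z by (auto simp: int_lattice_def elim: Ints_cases)
      then have vi: "v $ i = (if even m then 0 else 1)" by (simp add: v_def)
      show ?thesis
      proof (cases "even m")
        case True
        then obtain l where "m = 2 * l" by blast
        then have "x $ i = of_int l" using m vi True by (simp add: x_def)
        then show ?thesis by simp
      next
        case False
        then obtain l where "m = 2 * l + 1" by (elim oddE)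
        then have "x $ i = of_int l" using m vi False by (simp add: x_def)
        then show ?thesis by simp
      qed
    qed
    then show ?thesis by (simp add: int_lattice_def)
  qed
  show ?thesis
  proof (cases "v = 0")
    case True
    then show ?thesis using mms_affine_on_even_lattice[OF x] z_eq by simp
  next
    case False
    then obtain i where "v $ i = 1" by (auto simp: v_def vec_eq_iff split: if_splits)
    then have "T z = midpoint (T (2 *\<^sub>R x)) (T (2 *\<^sub>R (x + v)))"
      using mms_midpoint_lattice_step[OF x v] z_eq by (simp add: scaleR_add_right)
    also have "\<dots> = linear_part *v midpoint (2 *\<^sub>R x) (2 *\<^sub>R (x + v)) + T 0"
      by (simp add: mms_affine_on_even_lattice x v int_lattice_add matrix_affine_midpoint)
    also have "midpoint (2 *\<^sub>R x) (2 *\<^sub>R (x + v)) = z" by (simp add: midpoint_def z_eq vec_eq_iff)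
    finally show ?thesis .
  qed
qed

section \<open>The linear part is unimodular\<close>

text \<open>
  The simplex with vertices \<open>0\<close> and \<open>2n\<close> times the unit vectors contains the unit cube. Any integer
  point is moved into the image of that cube by subtracting the image of an integer vector, and there
  it has an integer preimage because integer points of the image simplex can be lifted.
\<close>

lemma unimodular_linear_part: "unimodular linear_part"
proof (rule unimodular_if_onto)
  define n where "n = real CARD('n)"
  define \<Delta> :: "(real ^ 'n) set" where "\<Delta> = insert 0 ((*\<^sub>R) (2 * n) ` Basis)"
  define G where "G x = linear_part *v x + T 0" for x
  have n: "n > 0" by (simp add: n_def)
  have G: "G = (\<lambda>x. linear_part *v x + T 0)" by (simp add: fun_eq_iff G_def)
  have "(2 * n) *\<^sub>R axis i 1 \<in> even_lattice" for i :: 'n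
    using double_in_even_lattice[OF int_lattice_scaleR[of n, OF _ int_lattice_axis[of i]]] by (simp add: n_def)
  then have ev: "\<Delta> \<subseteq> even_lattice"
    using double_in_even_lattice[OF int_lattice_zero] by (auto simp: \<Delta>_def Basis_vec_def)
  have inj: "inj ((*\<^sub>R) (2 * n) :: real ^ 'n \<Rightarrow> real ^ 'n)" using n by (auto simp: inj_def)
  have indep: "independent ((*\<^sub>R) (2 * n) ` (Basis :: (real ^ 'n) set))"
    by (intro linear_independent_injective_image inj_on_subset[OF inj] independent_Basis linear_scaleR subset_UNIV)
  moreover have "card ((*\<^sub>R) (2 * n) ` (Basis :: (real ^ 'n) set)) = CARD('n)"
    by (simp add: card_image[OF inj_on_subset[OF inj subset_UNIV]])
  moreover have "0 \<notin> (*\<^sub>R) (2 * n) ` (Basis :: (real ^ 'n) set)" using indep dependent_zero by blast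
  ultimately have simplex: "k_simplicial CARD('n) \<Delta>"
    using ev affine_dependent_imp_dependent2 by (auto simp: k_simplicial_iff \<Delta>_def)
  then have "k_simplicial CARD('n) (T ` \<Delta>)" by (rule mms_simplicial_image)
  then have "affine hull (T ` \<Delta>) = UNIV"
    by (intro affine_independent_span_eq) (simp_all add: k_simplicial_iff)
  moreover have T_G: "T ` \<Delta> = G ` \<Delta>"
    using ev even_lattice_subset_int_lattice by (intro image_cong) (auto simp: G_def mms_affine_on_int_lattice)
  moreover have "affine hull (G ` \<Delta>) = G ` (affine hull \<Delta>)"
    by (simp add: G affine_hull_matrix_affine)
  ultimately have "G ` (affine hull \<Delta>) = UNIV" by simp
  then have onto: "range G = UNIV" by blast
  have hull: "convex hull (G ` \<Delta>) = G ` (convex hull \<Delta>)"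
    by (simp add: G convex_hull_matrix_affine)
  \<comment> \<open>The coordinates of \<open>y\<close> sum to at most \<open>n\<close>, hence those of \<open>y / (2n)\<close> to at most \<open>1/2\<close>.\<close>
  have cube: "y \<in> convex hull \<Delta>" if "\<And>i. 0 \<le> y $ i \<and> y $ i \<le> 1" for y
  proof -
    define z where "z = (1 / (2 * n)) *\<^sub>R y"
    have comp: "0 \<le> z \<bullet> e \<and> z \<bullet> e \<le> 1 / (2 * n)" if "e \<in> Basis" for e
      using that \<open>\<And>i. 0 \<le> y $ i \<and> y $ i \<le> 1\<close> n
      by (auto simp: z_def Basis_vec_def inner_axis divide_simps)
    have "(\<Sum>e\<in>Basis. z \<bullet> e) \<le> (\<Sum>e\<in>(Basis :: (real ^ 'n) set). 1 / (2 * n))"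
      by (intro sum_mono) (use comp in blast)
    also have "\<dots> \<le> 1" using n by (simp add: n_def)
    finally have "z \<in> convex hull (insert 0 Basis)" using comp by (simp add: std_simplex)
    moreover have "\<Delta> = (*\<^sub>R) (2 * n) ` insert 0 Basis" by (simp add: \<Delta>_def)
    then have "convex hull \<Delta> = (*\<^sub>R) (2 * n) ` (convex hull (insert 0 Basis))"
      by (simp only: convex_hull_scaling)
    moreover have "y = (2 * n) *\<^sub>R z" using n by (simp add: z_def)
    ultimately show ?thesis by blast
  qed
  show "linear_part $ i $ j \<in> \<int>" for i j by (rule linear_part_Ints)
  show "\<exists>p\<in>int_lattice. linear_part *v p = q" if q: "q \<in> int_lattice" for q
  proof -
    obtain y where y: "q + T 0 = G y" using onto by blast
    define w :: "real ^ 'n" where "w = (\<chi> i. of_int \<lfloor>y $ i\<rfloor>)"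
    have w: "w \<in> int_lattice" by (simp add: w_def int_lattice_def)
    have "y - w \<in> convex hull \<Delta>"
      by (rule cube) (simp add: w_def, linarith)
    then have "G (y - w) \<in> convex hull (T ` \<Delta>)" by (simp add: T_G hull)
    moreover have Gyw: "G (y - w) = q - linear_part *v w + T 0"
      using y by (simp add: G_def matrix_vector_mult_diff_distrib)
    then have "G (y - w) \<in> int_lattice"
      using q w mms_zero_even even_lattice_subset_int_lattice
      by (auto intro!: int_lattice_add int_lattice_diff matrix_vector_int_lattice linear_part_Ints)
    ultimately obtain p where p: "p \<in> int_lattice" "T p = G (y - w)"
      using mms_hull_lift[OF simplex] by blast
    then have "linear_part *v (p + w) = q"
      using Gyw mms_affine_on_int_lattice[OF p(1)] by (simp add: matrix_vector_right_distrib)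
    then show ?thesis using int_lattice_add[OF p(1) w] by blast
  qed
qed

end

section \<open>MMS preserving maps and even unimodular affine maps\<close>

theorem theorem3p5:
  fixes T :: "real ^ 'n \<Rightarrow> real ^ 'n"
  shows "(T \<in> mms_group \<longleftrightarrow> T \<in> even_unimodular_affine) \<and>
    (mms_preserving T \<longleftrightarrow>
      (\<exists>A b. unimodular A \<and> b \<in> even_lattice \<and> (\<forall>x \<in> int_lattice. T x = A *v x + b))) \<and>
    (linear (\<lambda>x. T x - T 0) \<longrightarrow>
      (mms_preserving T \<longleftrightarrow>
        (\<exists>A b. unimodular A \<and> b \<in> even_lattice \<and> (\<forall>x. T x = A *v x + b))))"
proof -
  have suff: "mms_preserving T"
    if "unimodular A" "b \<in> even_lattice" "\<forall>x \<in> int_lattice. T x = A *v x + b" for A b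
  proof -
    interpret even_unimodular_map A b by unfold_locales (use that in auto)
    show ?thesis using that(3) by (intro mms_preserving_if_eq_on_int_lattice) (simp add: F_def)
  qed
  have nec: "\<exists>A b. unimodular A \<and> b \<in> even_lattice \<and> (\<forall>x \<in> int_lattice. T x = A *v x + b)"
    if "mms_preserving T"
    using unimodular_linear_part[OF that] mms_zero_even[OF that] mms_affine_on_int_lattice[OF that] by blast
  \<comment> \<open>Two linear maps that agree on the unit vectors, which are integer points, agree everywhere.\<close>
  have extend: "\<forall>x. T x = A *v x + b"
    if lin: "linear (\<lambda>x. T x - T 0)" and eq: "\<forall>x \<in> int_lattice. T x = A *v x + b" for A b
  proof -
    have T0: "T 0 = b" using bspec[OF eq int_lattice_zero] by simp
    have "(\<lambda>x. T x - T 0) = (*v) A"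
    proof (rule linear_eq_stdbasis[OF lin])
      fix e :: "real ^ 'n" assume "e \<in> Basis"
      then have "e \<in> int_lattice" by (auto simp: Basis_vec_def int_lattice_axis)
      then show "T e - T 0 = A *v e" using eq T0 by simp
    qed simp
    then show ?thesis using T0 by (metis diff_add_cancel)
  qed
  show ?thesis
    using suff nec extend unfolding mms_group_def even_unimodular_affine_def by blast
qed

end
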